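(* Let $c>1$ be a constant and let $p\in(0,1)$ be arbitrary (possibly $p=1-o(1)$). Consider the random wakeup rumor spreading algorithm $\mathrm{WU}$ on $n$ processors $0,1,\ldots,n-1$ with success rate $p$. Then with probability at least $1-n\exp\left(-\frac{(c-1)^2}{2c}\left(\lceil \log(n-1)\rceil-1\right)\right)$, the algorithm has delivered the rumor to all processors after $\frac{c}{p}\left(\lceil\log(n-1)\rceil+1\right)$ rounds.
   Context: $\log$ denotes the logarithm to base 2. For a sequence $s=(s_1,s_2,\ldots)$, $\mathrm{ODD}(s)=(s_1,s_3,\ldots)$ and $\mathrm{EVEN}(s)=(s_2,s_4,\ldots)$. The algorithm $\mathrm{WU}$ works in synchronous rounds. Initially processor $0$ holds the rumor and the list $(1,2,\ldots,n-1)$; all other processors hold empty lists. In each round, every processor $i$ holding a nonempty list $(j_1,\ldots,j_k)$ sends a wakeup request to $j_1$. Each wakeup request succeeds with probability $p$, independently of all other requests. If the request fails, $i$ keeps its list unchanged (and will send a request to $j_1$ again in the next round). If it succeeds, $i$ sends the rumor to $j_1$ together with the list $\mathrm{EVEN}(j_2,\ldots,j_k)=(j_3,j_5,\ldots)$, which becomes $j_1$'s list, and $i$ sets its own list to $\mathrm{ODD}(j_2,\ldots,j_k)=(j_2,j_4,\ldots)$. *)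

theory Defs
  imports "HOL-Probability.Probability"
begin

text \<open>
  \<open>ODD\<close> and \<open>EVEN\<close> keep the entries at odd and at even positions, where positions are
  counted from 1 (so \<open>ODD\<close> keeps the head).
\<close>
fun ODD :: "'a list \<Rightarrow> 'a list" and EVEN :: "'a list \<Rightarrow> 'a list" where
  "ODD [] = []"
| "ODD (x # xs) = x # EVEN xs"
| "EVEN [] = []"
| "EVEN (x # xs) = ODD xs"

record wu_state =
  informed :: "nat set"
  plist :: "nat \<Rightarrow> nat list"

definition wu_init :: "nat \<Rightarrow> wu_state" where
  "wu_init n = \<lparr>informed = {0}, plist = (\<lambda>i. if i = 0 then [1..<n] else [])\<rparr>"

text \<open>
  The synchronous effect of one round, where \<open>ok i\<close> says that processor \<open>i\<close> sent a request and
  that this request succeeded; the request of \<open>i\<close> goes to \<open>hd (plist s i)\<close>.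
  In every state reachable from \<open>wu_init n\<close> the lists of different processors are disjoint and
  a processor occurring in some list holds an empty list itself. Hence the sender of a
  successful request to \<open>v\<close> is unique, and the first two cases below do not overlap.
\<close>
definition wu_step :: "(nat \<Rightarrow> bool) \<Rightarrow> wu_state \<Rightarrow> wu_state" where
  "wu_step ok s =
    \<lparr>informed = informed s \<union> {hd (plist s i) | i. ok i},
     plist = (\<lambda>v.
       if ok v then ODD (tl (plist s v))
       else if \<exists>i. ok i \<and> hd (plist s i) = v
         then EVEN (tl (plist s (THE i. ok i \<and> hd (plist s i) = v)))
       else plist s v)\<rparr>"

text \<open>
  One independent Bernoulli trial for each processor with a nonempty list; \<open>Pi_pmf\<close> sets the
  outcome to \<open>False\<close> for all other processors, which send no request.
\<close>
definition wu_round :: "nat \<Rightarrow> real \<Rightarrow> wu_state \<Rightarrow> wu_state pmf" where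
  "wu_round n p s =
     map_pmf (\<lambda>ok. wu_step ok s)
       (Pi_pmf {i. i < n \<and> plist s i \<noteq> []} False (\<lambda>_. bernoulli_pmf p))"

text \<open>The distribution of the state after \<open>t\<close> rounds; fresh trials are drawn in every round.\<close>
primrec WU :: "nat \<Rightarrow> real \<Rightarrow> nat \<Rightarrow> wu_state pmf" where
  "WU n p 0 = return_pmf (wu_init n)"
| "WU n p (Suc t) = bind_pmf (WU n p t) (wu_round n p)"

end

theory Submission
  imports Defs "HOL-Library.Log_Nat"
begin

text \<open>
  Give a list of length \<open>L\<close> the weight \<open>L * c ^ floorlog 2 L\<close>, where \<open>floorlog 2 L\<close> is the bit
  length of \<open>L\<close>, and let the potential of a state be the total weight of its lists. A successful
  request drops one entry and splits the rest into two lists of length at most \<open>L div 2\<close>, so it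
  divides the weight of the sender's list by at least \<open>c\<close>. Hence every round multiplies the
  expected potential by at most \<open>1 - p + p / c\<close>. An uninformed processor occurs in some list
  and forces the potential to be at least \<open>c\<close>, so Markov's inequality bounds the failure
  probability; this merges the union bound over processors with the Chernoff bound.
\<close>

section \<open>Splitting a list into its odd and even positions\<close>

text \<open>Both lengths are proved jointly because the two functions call each other on the tail,
  so each induction step needs the other half.\<close>

lemma length_ODD_EVEN:
  "length (ODD xs) = (length xs + 1) div 2 \<and> length (EVEN xs) = length xs div 2"
  by (induction xs) auto

lemma set_ODD_EVEN: "set (ODD xs) \<union> set (EVEN xs) = set xs"
  by (induction xs) auto

lemma set_ODD_subset: "set (ODD xs) \<subseteq> set xs"
  and set_EVEN_subset: "set (EVEN xs) \<subseteq> set xs"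
  using set_ODD_EVEN[of xs] by auto

lemma distinct_ODD_EVEN:
  "distinct xs \<Longrightarrow>
    distinct (ODD xs) \<and> distinct (EVEN xs) \<and> set (ODD xs) \<inter> set (EVEN xs) = {}"
proof (induction xs)
  case (Cons x xs)
  then show ?case using set_EVEN_subset[of xs] set_ODD_subset[of xs] by auto
qed simp

section \<open>The weight of a list\<close>

text \<open>The factor \<open>real L\<close> plays the role of a union bound over the entries. The
  bit length is chosen as exponent because halving a positive length lowers it by exactly
  one.\<close>

definition weight :: "real \<Rightarrow> nat \<Rightarrow> real" where
  "weight c L = real L * c ^ floorlog 2 L"

lemma weight_0 [simp]: "weight c 0 = 0"
  by (simp add: weight_def)

lemma weight_nonneg: "c \<ge> 0 \<Longrightarrow> weight c L \<ge> 0"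
  by (simp add: weight_def)

lemma weight_ge:
  assumes "c \<ge> 1" "L > 0"
  shows "weight c L \<ge> c"
proof -
  have "c ^ 1 \<le> c ^ floorlog 2 L"
    using assms by (intro power_increasing) (simp_all add: compute_floorlog[of 2 L])
  also have "\<dots> \<le> real L * c ^ floorlog 2 L"
    using assms by (simp add: mult_le_cancel_right1)
  finally show ?thesis by (simp add: weight_def)
qed

text \<open>The two lengths are those of \<open>ODD\<close> and \<open>EVEN\<close> applied to the
  tail of a list of length \<open>L\<close>. Both are at most \<open>L div 2\<close>, whose bit
  length is one less than that of \<open>L\<close>, and their sum does not exceed
  \<open>L\<close>.\<close>

lemma weight_split:
  assumes c: "c \<ge> 1" and L: "L > 0"
  shows "weight c (L div 2) + weight c ((L - 1) div 2) \<le> weight c L / c"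
proof -
  let ?k = "floorlog 2 (L div 2)"
  have k: "floorlog 2 L = Suc ?k"
    using L by (simp add: compute_floorlog[of 2 L])
  have "c ^ floorlog 2 ((L - 1) div 2) \<le> c ^ ?k"
    using c by (intro power_increasing floorlog_mono) auto
  then have "weight c (L div 2) + weight c ((L - 1) div 2)
      \<le> real (L div 2) * c ^ ?k + real ((L - 1) div 2) * c ^ ?k"
    by (simp add: weight_def mult_left_mono)
  also have "\<dots> = real (L div 2 + (L - 1) div 2) * c ^ ?k"
    by (simp add: distrib_right)
  also have "\<dots> \<le> real L * c ^ ?k"
    using c by (intro mult_right_mono) auto
  also have "\<dots> = weight c L / c"
    using c by (simp add: weight_def k)
  finally show ?thesis .
qed

section \<open>The potential and the invariant of reachable states\<close>

definition potential :: "real \<Rightarrow> nat \<Rightarrow> wu_state \<Rightarrow> real" where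
  "potential c n s = (\<Sum>i<n. weight c (length (plist s i)))"

text \<open>Disjointness makes the sender of a request unique, which gives the \<open>THE\<close> in
  \<open>wu_step\<close> its meaning. Empty lists of listed processors ensure that a delivery
  overwrites nothing. The last clause ties failure to a nonempty list.\<close>

definition wu_inv :: "nat \<Rightarrow> wu_state \<Rightarrow> bool" where
  "wu_inv n s \<longleftrightarrow>
    (\<forall>j. \<forall>u\<in>set (plist s j). u < n) \<and>
    (\<forall>j\<ge>n. plist s j = []) \<and>
    (\<forall>j. distinct (plist s j)) \<and>
    (\<forall>i j u. u \<in> set (plist s i) \<longrightarrow> u \<in> set (plist s j) \<longrightarrow> i = j) \<and>
    (\<forall>j. \<forall>u\<in>set (plist s j). plist s u = []) \<and>
    (\<forall>i<n. i \<in> informed s \<or> (\<exists>j. i \<in> set (plist s j)))"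

lemma wu_invD:
  assumes "wu_inv n s"
  shows "u \<in> set (plist s j) \<Longrightarrow> u < n"
    and "j \<ge> n \<Longrightarrow> plist s j = []"
    and "distinct (plist s j)"
    and "u \<in> set (plist s i) \<Longrightarrow> u \<in> set (plist s j) \<Longrightarrow> i = j"
    and "u \<in> set (plist s j) \<Longrightarrow> plist s u = []"
    and "i < n \<Longrightarrow> i \<in> informed s \<or> (\<exists>j. i \<in> set (plist s j))"
  using assms unfolding wu_inv_def by simp_all

lemma wu_inv_init: "n \<ge> 1 \<Longrightarrow> wu_inv n (wu_init n)"
  by (auto simp: wu_inv_def wu_init_def)

lemma hd_plist_unique:
  assumes "wu_inv n s" "plist s i \<noteq> []" "plist s j \<noteq> []" "hd (plist s i) = hd (plist s j)"
  shows "i = j"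
  using assms wu_invD(4)[OF assms(1)] by (metis hd_in_set)

text \<open>The receiver occurs in a list, so its own list is empty and it cannot be a successful
  sender; disjointness identifies the \<open>THE\<close> term with \<open>i\<close>.\<close>

lemma plist_wu_step_receiver:
  assumes inv: "wu_inv n s" and ok: "\<forall>i. ok i \<longrightarrow> plist s i \<noteq> []" and "ok i"
  shows "plist (wu_step ok s) (hd (plist s i)) = EVEN (tl (plist s i))"
proof -
  have "\<not> ok (hd (plist s i))"
    using wu_invD(5)[OF inv hd_in_set] ok \<open>ok i\<close> by blast
  moreover have "(THE j. ok j \<and> hd (plist s j) = hd (plist s i)) = i"
    using hd_plist_unique[OF inv] ok \<open>ok i\<close> by (intro the_equality) auto
  ultimately show ?thesis
    using \<open>ok i\<close> by (auto simp: wu_step_def)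
qed

lemma plist_wu_step_cases [consumes 2, case_names sender receiver idle]:
  assumes inv: "wu_inv n s" and ok: "\<forall>i. ok i \<longrightarrow> plist s i \<noteq> []"
  obtains "ok v" "plist (wu_step ok s) v = ODD (tl (plist s v))"
  | i where "ok i" "hd (plist s i) = v" "plist (wu_step ok s) v = EVEN (tl (plist s i))"
  | "\<not> ok v" "\<forall>i. ok i \<longrightarrow> hd (plist s i) \<noteq> v" "plist (wu_step ok s) v = plist s v"
proof -
  consider "ok v" | i where "ok i" "hd (plist s i) = v"
    | "\<not> ok v" "\<forall>i. ok i \<longrightarrow> hd (plist s i) \<noteq> v"
    by blast
  then show thesis
  proof cases
    case 1
    then show thesis by (intro that(1)) (simp_all add: wu_step_def)
  next
    case 2
    then show thesis using plist_wu_step_receiver[OF inv ok] by (intro that(2)) auto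
  next
    case 3
    then show thesis by (intro that(3)) (auto simp: wu_step_def)
  qed
qed

lemma set_tl_subset: "set (tl xs) \<subseteq> set xs"
  by (cases xs) auto

lemma wu_inv_step:
  assumes inv: "wu_inv n s" and ok: "\<forall>i. ok i \<longrightarrow> plist s i \<noteq> []"
  shows "wu_inv n (wu_step ok s)"
proof -
  let ?l = "plist s" and ?l' = "plist (wu_step ok s)"
  note D = wu_invD[OF inv]
  have nhd: "hd (?l i) \<notin> set (tl (?l i))" if "ok i" for i
    using D(3)[of i] ok[rule_format, OF that] by (cases "?l i") auto
  have hd_in: "hd (?l i) \<in> set (?l i)" if "ok i" for i
    using ok[rule_format, OF that] by simp
  \<comment> \<open>Every entry \<open>u\<close> of a new list is traced to an old list
    \<open>w\<close>: the new holder \<open>v\<close> is \<open>w\<close> itself or, after a success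
    of \<open>w\<close>, possibly the head of that list. The remaining clauses are read off from
    this.\<close>
  have origin: "\<exists>w. u \<in> set (?l w) \<and>
      (ok w \<and> u \<in> set (tl (?l w)) \<and> (v = w \<and> u \<in> set (ODD (tl (?l w)))
         \<or> v = hd (?l w) \<and> u \<in> set (EVEN (tl (?l w))))
       \<or> \<not> ok w \<and> v = w)" if "u \<in> set (?l' v)" for u v
    using inv ok
  proof (cases rule: plist_wu_step_cases[where v = v])
    case sender
    then show ?thesis
      using that set_ODD_subset[of "tl (?l v)"] set_tl_subset[of "?l v"] by auto
  next
    case (receiver i)
    then show ?thesis
      using that set_EVEN_subset[of "tl (?l i)"] set_tl_subset[of "?l i"] by auto
  next
    case idle
    then show ?thesis using that by auto
  qed
  \<comment> \<open>A processor that has just been woken up disappears from all lists: it occurred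
    only in the list of its sender, and there only as the head.\<close>
  have not_hd: "hd (?l i) \<noteq> u" if mem: "u \<in> set (?l' v)" and oki: "ok i" for u v i
  proof
    assume u: "hd (?l i) = u"
    obtain w where w: "u \<in> set (?l w)" "ok w \<Longrightarrow> u \<in> set (tl (?l w))"
      using origin[OF mem] by blast
    have "w = i" using D(4) w(1) hd_in[OF oki] u by blast
    then show False using w(2) nhd[OF oki] oki u by blast
  qed
  have "u < n" if "u \<in> set (?l' v)" for u v
    using origin[OF that] D(1) by blast
  moreover have "?l' v = []" if "v \<ge> n" for v
    using inv ok
  proof (cases rule: plist_wu_step_cases[where v = v])
    case sender
    then show ?thesis using ok D(2) that by blast
  next
    case (receiver i)
    then show ?thesis using hd_in D(1)[of v i] that by auto
  next
    case idle
    then show ?thesis using D(2) that by simp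
  qed
  moreover have "distinct (?l' v)" for v
    using inv ok
  proof (cases rule: plist_wu_step_cases[where v = v])
    case sender
    then show ?thesis using distinct_ODD_EVEN[OF distinct_tl[OF D(3)]] by simp
  next
    case (receiver i)
    then show ?thesis using distinct_ODD_EVEN[OF distinct_tl[OF D(3)]] by simp
  next
    case idle
    then show ?thesis using D(3) by simp
  qed
  moreover have "v = v'" if u: "u \<in> set (?l' v)" "u \<in> set (?l' v')" for u v v'
  proof -
    obtain w where w: "u \<in> set (?l w)"
      "ok w \<and> (v = w \<and> u \<in> set (ODD (tl (?l w)))
         \<or> v = hd (?l w) \<and> u \<in> set (EVEN (tl (?l w)))) \<or> \<not> ok w \<and> v = w"
      using origin[OF u(1)] by blast
    obtain w' where w': "u \<in> set (?l w')"
      "ok w' \<and> (v' = w' \<and> u \<in> set (ODD (tl (?l w')))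
         \<or> v' = hd (?l w') \<and> u \<in> set (EVEN (tl (?l w')))) \<or> \<not> ok w' \<and> v' = w'"
      using origin[OF u(2)] by blast
    have "w' = w" using D(4) w(1) w'(1) by blast
    then show ?thesis
      using w(2) w'(2) distinct_ODD_EVEN[OF distinct_tl[OF D(3)], of w] by blast
  qed
  moreover have "?l' u = []" if u: "u \<in> set (?l' v)" for u v
    using inv ok
  proof (cases rule: plist_wu_step_cases[where v = u])
    case sender
    then show ?thesis using origin[OF u] D(5) ok by blast
  next
    case (receiver i)
    then show ?thesis using not_hd[OF u] by blast
  next
    case idle
    then show ?thesis using origin[OF u] D(5) by force
  qed
  moreover have "u \<in> informed (wu_step ok s) \<or> (\<exists>j. u \<in> set (?l' j))" if un: "u < n" for u
  proof (rule ccontr)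
    assume "\<not> ?thesis"
    then have ni: "u \<notin> informed s" "\<And>i. ok i \<Longrightarrow> u \<noteq> hd (?l i)"
      and nl: "\<And>j. u \<notin> set (?l' j)"
      by (auto simp: wu_step_def)
    obtain j where j: "u \<in> set (?l j)" using D(6)[OF un] ni by blast
    have nj: "?l j \<noteq> []" using j by auto
    show False
    \<comment> \<open>If the holder \<open>j\<close> of \<open>u\<close> succeeds, \<open>u\<close>
      is not the head and survives in one of the two halves. Otherwise \<open>j\<close> keeps its
      list, since a processor with a nonempty list receives no request.\<close>
    proof (cases "ok j")
      case True
      then have "u \<in> set (tl (?l j))" using j ni(2)[OF True] nj by (cases "?l j") auto
      then have "u \<in> set (?l' j) \<or> u \<in> set (?l' (hd (?l j)))"
        using set_ODD_EVEN[of "tl (?l j)"] plist_wu_step_receiver[OF inv ok True] True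
        by (auto simp: wu_step_def)
      then show False using nl by blast
    next
      case False
      have "hd (?l i) \<noteq> j" if "ok i" for i
        using D(5)[OF hd_in[OF that]] nj by blast
      then have "?l' j = ?l j" using False by (auto simp: wu_step_def)
      then show False using nl j by metis
    qed
  qed
  ultimately show ?thesis
    unfolding wu_inv_def by blast
qed

section \<open>Change of the potential in one round with fixed outcomes\<close>

text \<open>The weight of each delivered \<open>EVEN\<close> half is charged back to its sender,
  where \<open>weight_split\<close> bounds it together with the \<open>ODD\<close> half.\<close>

lemma potential_wu_step_le:
  assumes inv: "wu_inv n s" and ok: "\<forall>i. ok i \<longrightarrow> plist s i \<noteq> []" and c: "c \<ge> 1"
  shows "potential c n (wu_step ok s)
    \<le> (\<Sum>i<n. if ok i then weight c (length (plist s i)) / c else weight c (length (plist s i)))"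
proof -
  let ?W = "\<lambda>xs. weight c (length xs)" and ?l = "plist s" and ?l' = "plist (wu_step ok s)"
  let ?E = "\<lambda>i. if ok i then ?W (EVEN (tl (?l i))) else 0"
  have W: "?W xs \<ge> 0" for xs :: "nat list" using c by (intro weight_nonneg) simp
  have lt: "i < n" if "ok i" for i
    using ok[rule_format, OF that] wu_invD(2)[OF inv] by (meson not_le)
  have hd_lt: "hd (?l i) < n" if "ok i" for i
    using ok[rule_format, OF that] wu_invD(1)[OF inv hd_in_set] by blast
  have E: "?E i \<ge> 0" for i using W by simp
  \<comment> \<open>The second sum collects what \<open>v\<close> receives. Writing it over all
    possible senders allows the order of summation to be exchanged below.\<close>
  have point: "?W (?l' v) \<le> (if ok v then ?W (ODD (tl (?l v))) else ?W (?l v))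
      + (\<Sum>i<n. if hd (?l i) = v then ?E i else 0)" (is "_ \<le> ?own v + ?rcv v") for v
  proof -
    have r: "?rcv v \<ge> 0" using E by (intro sum_nonneg) auto
    show ?thesis
      using inv ok
    proof (cases rule: plist_wu_step_cases[where v = v])
      case sender
      then show ?thesis using r by simp
    next
      case (receiver i)
      have "?W (?l' v) = (if hd (?l i) = v then ?E i else 0)" using receiver by simp
      also have "\<dots> \<le> ?rcv v"
        using lt[OF receiver(1)] E by (intro member_le_sum) auto
      also have "\<dots> \<le> ?own v + ?rcv v" using W by simp
      finally show ?thesis .
    next
      case idle
      then show ?thesis using r by simp
    qed
  qed
  have "potential c n (wu_step ok s) \<le> (\<Sum>v<n. (if ok v then ?W (ODD (tl (?l v))) else ?W (?l v))
      + (\<Sum>i<n. if hd (?l i) = v then ?E i else 0))"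
    unfolding potential_def by (intro sum_mono point)
  also have "\<dots> = (\<Sum>v<n. if ok v then ?W (ODD (tl (?l v))) else ?W (?l v))
      + (\<Sum>i<n. \<Sum>v<n. if hd (?l i) = v then ?E i else 0)"
    unfolding sum.distrib by (intro arg_cong2[where f = "(+)"] refl sum.swap)
  \<comment> \<open>A successful sender has exactly one receiver below \<open>n\<close>. For all
    other \<open>i\<close> the term \<open>?E i\<close> is 0, so the unspecified head of an empty
    list does no harm.\<close>
  also have "(\<Sum>i<n. \<Sum>v<n. if hd (?l i) = v then ?E i else 0) = (\<Sum>i<n. ?E i)"
    using hd_lt by (intro sum.cong) auto
  also have "(\<Sum>v<n. if ok v then ?W (ODD (tl (?l v))) else ?W (?l v)) + \<dots>
      = (\<Sum>i<n. (if ok i then ?W (ODD (tl (?l i))) else ?W (?l i)) + ?E i)"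
    by (simp only: sum.distrib)
  also have "\<dots> \<le> (\<Sum>i<n. if ok i then ?W (?l i) / c else ?W (?l i))"
  proof (intro sum_mono)
    fix i
    show "(if ok i then ?W (ODD (tl (?l i))) else ?W (?l i)) + ?E i
        \<le> (if ok i then ?W (?l i) / c else ?W (?l i))"
      using weight_split[OF c, of "length (?l i)"] ok
      by (auto simp: length_ODD_EVEN)
  qed
  finally show ?thesis .
qed

section \<open>Expected potential after several rounds\<close>

lemma set_pmf_wu_round:
  assumes "s' \<in> set_pmf (wu_round n p s)"
  obtains ok where "s' = wu_step ok s" "\<forall>i. ok i \<longrightarrow> plist s i \<noteq> []"
proof -
  let ?A = "{i. i < n \<and> plist s i \<noteq> []}"
  obtain ok where ok: "s' = wu_step ok s" "ok \<in> set_pmf (Pi_pmf ?A False (\<lambda>_. bernoulli_pmf p))"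
    using assms by (auto simp: wu_round_def)
  \<comment> \<open>The default \<open>False\<close> outside \<open>?A\<close> is what makes every
    successful processor hold a nonempty list.\<close>
  moreover have "ok \<in> PiE_dflt ?A False (\<lambda>_. set_pmf (bernoulli_pmf p))"
    using ok(2) set_Pi_pmf_subset[of ?A False "\<lambda>_. bernoulli_pmf p"]
    by (auto simp: set_Pi_pmf)
  ultimately show thesis
    by (intro that[of ok]) (auto simp: PiE_dflt_def)
qed

lemma wu_inv_WU: "n \<ge> 1 \<Longrightarrow> s \<in> set_pmf (WU n p t) \<Longrightarrow> wu_inv n s"
proof (induction t arbitrary: s)
  case 0
  then show ?case by (simp add: wu_inv_init)
next
  case (Suc t)
  then obtain s0 where "wu_inv n s0" "s \<in> set_pmf (wu_round n p s0)"
    by auto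
  then show ?case by (metis set_pmf_wu_round wu_inv_step)
qed

text \<open>By linearity of expectation it suffices to look at one list at a time: its weight is
  divided by \<open>c\<close> with probability \<open>p\<close> and kept with probability
  \<open>1 - p\<close>.\<close>

lemma nn_integral_potential_round:
  assumes inv: "wu_inv n s" and c: "c \<ge> 1" and p: "0 \<le> p" "p \<le> 1"
  shows "(\<integral>\<^sup>+s'. ennreal (potential c n s') \<partial>wu_round n p s)
    \<le> ennreal (1 - p + p / c) * ennreal (potential c n s)"
proof -
  let ?A = "{i. i < n \<and> plist s i \<noteq> []}" and ?w = "\<lambda>i. weight c (length (plist s i))"
  let ?M = "Pi_pmf ?A False (\<lambda>_. bernoulli_pmf p)"
  let ?f = "\<lambda>i b. if b then ?w i / c else ?w i"
  have w: "?w i \<ge> 0" for i using c by (intro weight_nonneg) simp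
  have f: "?f i b \<ge> 0" for i b using w c by simp
  have comp: "(\<integral>\<^sup>+ok. ennreal (?f i (ok i)) \<partial>?M) = ennreal ((1 - p + p / c) * ?w i)" if "i < n" for i
  proof (cases "i \<in> ?A")
    case True
    have "(\<integral>\<^sup>+ok. ennreal (?f i (ok i)) \<partial>?M)
        = (\<integral>\<^sup>+b. ennreal (?f i b) \<partial>map_pmf (\<lambda>ok. ok i) ?M)"
      by simp
    also have "map_pmf (\<lambda>ok. ok i) ?M = bernoulli_pmf p"
      using True by (subst Pi_pmf_component) auto
    also have "(\<integral>\<^sup>+b. ennreal (?f i b) \<partial>bernoulli_pmf p)
        = ennreal (?w i / c) * ennreal p + ennreal (?w i) * ennreal (1 - p)"
      using p w[of i] c by (subst nn_integral_bernoulli_pmf) auto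
    also have "\<dots> = ennreal (?w i / c * p + ?w i * (1 - p))"
      using p w c by (simp add: ennreal_mult[symmetric] ennreal_plus[symmetric] del: ennreal_plus)
    also have "?w i / c * p + ?w i * (1 - p) = (1 - p + p / c) * ?w i"
      by (simp add: algebra_simps)
    finally show ?thesis .
  next
    case False
    \<comment> \<open>A processor below \<open>n\<close> outside \<open>?A\<close> has an empty
      list, so both sides vanish.\<close>
    then have "?w i = 0" using that by simp
    then show ?thesis by (simp cong: if_cong)
  qed
  have "(\<integral>\<^sup>+s'. ennreal (potential c n s') \<partial>wu_round n p s)
      = (\<integral>\<^sup>+ok. ennreal (potential c n (wu_step ok s)) \<partial>?M)"
    by (simp add: wu_round_def)
  also have "\<dots> \<le> (\<integral>\<^sup>+ok. ennreal (\<Sum>i<n. ?f i (ok i)) \<partial>?M)"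
  proof (intro nn_integral_mono_AE AE_pmfI ennreal_leI)
    fix ok assume "ok \<in> set_pmf ?M"
    then have "ok \<in> PiE_dflt ?A False (\<lambda>_. set_pmf (bernoulli_pmf p))"
      by (simp add: set_Pi_pmf)
    then have "\<forall>i. ok i \<longrightarrow> plist s i \<noteq> []" by (auto simp: PiE_dflt_def)
    then show "potential c n (wu_step ok s) \<le> (\<Sum>i<n. ?f i (ok i))"
      using potential_wu_step_le[OF inv _ c] by simp
  qed
  also have "\<dots> = (\<Sum>i<n. \<integral>\<^sup>+ok. ennreal (?f i (ok i)) \<partial>?M)"
    using f by (subst nn_integral_sum[symmetric]) (auto intro!: nn_integral_cong sum_ennreal[symmetric])
  also have "\<dots> = (\<Sum>i<n. ennreal ((1 - p + p / c) * ?w i))"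
    by (intro sum.cong) (simp_all add: comp)
  also have "\<dots> = ennreal (\<Sum>i<n. (1 - p + p / c) * ?w i)"
    using w p c by (intro sum_ennreal) simp
  also have "\<dots> = ennreal (1 - p + p / c) * ennreal (potential c n s)"
    using p c w by (simp add: potential_def sum_distrib_left[symmetric] ennreal_mult sum_nonneg)
  finally show ?thesis .
qed

text \<open>The one-round bound is iterated, starting from the single list of length
  \<open>n - 1\<close> at processor 0.\<close>

lemma nn_integral_potential_WU:
  assumes n: "n \<ge> 1" and c: "c \<ge> 1" and p: "0 \<le> p" "p \<le> 1"
  shows "(\<integral>\<^sup>+s. ennreal (potential c n s) \<partial>WU n p t)
    \<le> ennreal ((1 - p + p / c) ^ t * weight c (n - 1))"
proof (induction t)
  case 0
  have "potential c n (wu_init n) = (\<Sum>i<n. if i = 0 then weight c (n - 1) else 0)"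
    unfolding potential_def by (intro sum.cong) (auto simp: wu_init_def)
  then show ?case using n by simp
next
  case (Suc t)
  let ?q = "1 - p + p / c"
  have q: "?q \<ge> 0" using p c by simp
  have "(\<integral>\<^sup>+s. ennreal (potential c n s) \<partial>WU n p (Suc t))
      = (\<integral>\<^sup>+s. \<integral>\<^sup>+s'. ennreal (potential c n s') \<partial>wu_round n p s \<partial>WU n p t)"
    by simp
  also have "\<dots> \<le> (\<integral>\<^sup>+s. ennreal ?q * ennreal (potential c n s) \<partial>WU n p t)"
    using wu_inv_WU[OF n] c p
    by (intro nn_integral_mono_AE AE_pmfI nn_integral_potential_round) auto
  also have "\<dots> = ennreal ?q * (\<integral>\<^sup>+s. ennreal (potential c n s) \<partial>WU n p t)"
    by (intro nn_integral_cmult) simp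
  also have "\<dots> \<le> ennreal ?q * ennreal (?q ^ t * weight c (n - 1))"
    by (intro mult_left_mono Suc) simp
  also have "\<dots> = ennreal (?q ^ Suc t * weight c (n - 1))"
    using q by (simp add: ennreal_mult'[symmetric] mult.assoc)
  finally show ?case .
qed

section \<open>From the expected potential to the failure probability\<close>

lemma potential_ge_uninformed:
  assumes inv: "wu_inv n s" and c: "c \<ge> 1" and i: "i < n" "i \<notin> informed s"
  shows "potential c n s \<ge> c"
proof -
  obtain j where j: "i \<in> set (plist s j)" using wu_invD(6)[OF inv i(1)] i(2) by blast
  then have nj: "plist s j \<noteq> []" by auto
  then have "j < n" using wu_invD(2)[OF inv] by (meson not_le)
  have "c \<le> weight c (length (plist s j))" using c nj by (intro weight_ge) simp_all
  also have "\<dots> \<le> potential c n s"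
    unfolding potential_def using \<open>j < n\<close> c
    by (intro member_le_sum) (auto intro!: weight_nonneg)
  finally show ?thesis .
qed

text \<open>This is Markov's inequality at the threshold \<open>c\<close>, which the potential
  reaches whenever some processor is uninformed.\<close>

lemma prob_not_all_informed:
  assumes n: "n \<ge> 1" and c: "c \<ge> 1" and p: "0 \<le> p" "p \<le> 1"
  shows "measure_pmf.prob (WU n p t) {s. \<not> (\<forall>i<n. i \<in> informed s)}
    \<le> (1 - p + p / c) ^ t * weight c (n - 1) / c"
proof -
  let ?B = "{s. \<not> (\<forall>i<n. i \<in> informed s)}" and ?W = "WU n p t"
  let ?b = "(1 - p + p / c) ^ t * weight c (n - 1)"
  have q: "1 - p + p / c \<ge> 0" using p c by simp
  have b: "?b \<ge> 0" using c by (intro mult_nonneg_nonneg zero_le_power[OF q] weight_nonneg) simp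
  have "ennreal (c * measure_pmf.prob ?W ?B) = ennreal c * emeasure ?W ?B"
    using c by (simp only: measure_pmf.emeasure_eq_measure ennreal_mult')
  also have "\<dots> = (\<integral>\<^sup>+s. ennreal c * indicator ?B s \<partial>?W)"
    by (rule nn_integral_cmult_indicator[symmetric]) simp
  also have "\<dots> \<le> (\<integral>\<^sup>+s. ennreal (potential c n s) \<partial>?W)"
  proof (intro nn_integral_mono_AE AE_pmfI)
    fix s assume "s \<in> set_pmf ?W"
    then have "wu_inv n s" using wu_inv_WU[OF n] by blast
    then show "ennreal c * indicator ?B s \<le> ennreal (potential c n s)"
      using potential_ge_uninformed[OF _ c] by (auto simp: indicator_def intro!: ennreal_leI)
  qed
  also have "\<dots> \<le> ennreal ?b" by (rule nn_integral_potential_WU[OF n c p])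
  finally have "c * measure_pmf.prob ?W ?B \<le> ?b" using b by (simp add: ennreal_le_iff)
  then show ?thesis using c by (simp add: field_simps)
qed

section \<open>Estimates for the tail\<close>

text \<open>The function \<open>x - 1 / x - 2 * ln x\<close> vanishes at 1 and has derivative
  \<open>(1 - 1 / x)\<^sup>2\<close>, hence is nonnegative on \<open>x \<ge> 1\<close>.\<close>

lemma ln_le_half_diff_inverse:
  fixes c :: real
  assumes "c \<ge> 1"
  shows "ln c \<le> (c\<^sup>2 - 1) / (2 * c)"
proof -
  let ?g = "\<lambda>x::real. x - 1 / x - 2 * ln x"
  have "?g 1 \<le> ?g c"
  proof (rule DERIV_nonneg_imp_nondecreasing[OF assms])
    fix x :: real assume x: "1 \<le> x" "x \<le> c"
    have "DERIV ?g x :> 1 + 1 / x\<^sup>2 - 2 * (1 / x)"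
      using x by (auto intro!: derivative_eq_intros simp: power2_eq_square)
    moreover have "1 + 1 / x\<^sup>2 - 2 * (1 / x) = (1 - 1 / x)\<^sup>2"
      using x by (simp add: power2_eq_square field_simps)
    ultimately show "\<exists>y. DERIV ?g x :> y \<and> y \<ge> 0"
      by (metis zero_le_power2)
  qed
  then show ?thesis using assms by (simp add: field_simps power2_eq_square)
qed

text \<open>
  Here \<open>t\<close> is the number of rounds and \<open>K\<close> bounds the exponent left in the potential. Rounding
  the number of rounds down loses less than one round.
\<close>
lemma tail_bound:
  fixes c p :: real and K t :: nat
  assumes c: "c > 1" and p: "0 < p" "p < 1" and t: "real t \<ge> c / p * (real K + 1) - 1"
  shows "(1 - p + p / c) ^ t * c ^ K \<le> exp (- ((c - 1)\<^sup>2 / (2 * c)) * (real K - 1))"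
proof -
  define d where "d = 1 - 1 / c"
  define g where "g = (c - 1)\<^sup>2 / (2 * c)"
  have d: "0 \<le> d" using c by (simp add: d_def)
  have cd: "c * d = c - 1" using c by (simp add: d_def algebra_simps)
  have q0: "0 \<le> 1 - p + p / c" using c p by simp
  have "1 - p + p / c = 1 + - (p * d)" by (simp add: d_def algebra_simps)
  also have "\<dots> \<le> exp (- (p * d))" by (rule exp_ge_add_one_self)
  finally have "(1 - p + p / c) ^ t \<le> exp (- (p * d)) ^ t"
    using q0 by (rule power_mono)
  also have "\<dots> = exp (- (real t * p * d))"
    by (simp add: exp_of_nat_mult[symmetric] mult.assoc)
  finally have q: "(1 - p + p / c) ^ t \<le> exp (- (real t * p * d))" .
  have "c ^ K = exp (real K * ln c)"
    using c by (simp add: exp_of_nat_mult)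
  with q have "(1 - p + p / c) ^ t * c ^ K \<le> exp (- (real t * p * d)) * exp (real K * ln c)"
    by simp
  also have "\<dots> = exp (real K * ln c - real t * p * d)"
    by (simp add: exp_add[symmetric])
  also have "\<dots> \<le> exp (- g * (real K - 1))"
  proof (subst exp_le_cancel_iff)
    have "(c / p * (real K + 1) - 1) * p \<le> real t * p"
      using t p by (intro mult_right_mono) auto
    moreover have "(c / p * (real K + 1) - 1) * p = c * (real K + 1) - p"
      using p by (simp add: field_simps)
    \<comment> \<open>Rounding down costs at most \<open>p\<close> here, and \<open>p < 1\<close>
      turns this into a bound free of \<open>p\<close>.\<close>
    ultimately have "c * (real K + 1) - 1 \<le> real t * p" using p by linarith
    then have "(c * (real K + 1) - 1) * d \<le> real t * p * d"
      using d by (intro mult_right_mono)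
    moreover have "(c * (real K + 1) - 1) * d = (c - 1) * (real K + 1) - d"
      by (simp add: algebra_simps flip: cd)
    \<comment> \<open>The logarithmic estimate was chosen so that its right-hand side is exactly
      \<open>c - 1 - g\<close>; this produces the constant of the theorem.\<close>
    moreover have "real K * ln c \<le> real K * (c - 1 - g)"
    proof -
      have "(c\<^sup>2 - 1) / (2 * c) = c - 1 - g"
        using c by (simp add: g_def field_simps power2_eq_square)
      then show ?thesis
        using ln_le_half_diff_inverse[of c] c by (intro mult_left_mono) auto
    qed
    \<comment> \<open>The rounding loss \<open>d\<close> is covered by the gain \<open>c - 1\<close>
      from the \<open>+ 1\<close> in \<open>real K + 1\<close>.\<close>
    moreover have "d \<le> c - 1"
    proof -
      have "c - 1 - d = (c - 1)\<^sup>2 / c"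
        using c by (simp add: d_def field_simps power2_eq_square)
      then show ?thesis using c by (smt (verit) divide_nonneg_pos zero_le_power2)
    qed
    moreover have "0 \<le> g" using c by (simp add: g_def)
    ultimately show "real K * ln c - real t * p * d \<le> - g * (real K - 1)"
      by (simp add: algebra_simps)
  qed
  finally show ?thesis unfolding g_def .
qed

section \<open>The bound for the stated number of rounds\<close>

theorem theorem5:
  fixes c p :: real and n :: nat
  assumes "c > 1" and "0 < p" and "p < 1" and "n \<ge> 2"
  shows "measure_pmf.prob
           (WU n p (nat \<lfloor>c / p * (real_of_int \<lceil>log 2 (real n - 1)\<rceil> + 1)\<rfloor>))
           {s. \<forall>i<n. i \<in> informed s}
         \<ge> 1 - real n * exp (- ((c - 1)\<^sup>2 / (2 * c)) * (real_of_int \<lceil>log 2 (real n - 1)\<rceil> - 1))"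
proof -
  define K where "K = nat \<lceil>log 2 (real n - 1)\<rceil>"
  define t where "t = nat \<lfloor>c / p * (real K + 1)\<rfloor>"
  have log0: "0 \<le> log 2 (real n - 1)" using assms by simp
  then have K: "real_of_int \<lceil>log 2 (real n - 1)\<rceil> = real K"
    by (simp add: K_def)
  have t: "real t \<ge> c / p * (real K + 1) - 1"
    unfolding t_def by linarith
  \<comment> \<open>The bit length of \<open>n - 1\<close> is the floor of its logarithm plus one,
    while \<open>K\<close> is the ceiling.\<close>
  have fl: "floorlog 2 (n - 1) \<le> Suc K"
    using assms log0 unfolding floorlog_def K_def by (auto simp: of_nat_diff nat_mono floor_le_ceiling)
  have "weight c (n - 1) \<le> real n * c ^ Suc K"
    unfolding weight_def using assms fl by (intro mult_mono power_increasing) auto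
  \<comment> \<open>The division by \<open>c\<close> from Markov's inequality cancels the extra
    factor, leaving the exponent \<open>K\<close> that \<open>tail_bound\<close> expects.\<close>
  then have wt: "weight c (n - 1) / c \<le> real n * c ^ K"
    using assms by (simp add: field_simps)
  let ?S = "{s. \<forall>i<n. i \<in> informed s}"
  have q0: "0 \<le> 1 - p + p / c" using assms by simp
  have "1 - measure_pmf.prob (WU n p t) ?S = measure_pmf.prob (WU n p t) (- ?S)"
    by (subst measure_pmf.prob_compl[symmetric]) (auto simp: Compl_eq_Diff_UNIV)
  also have "- ?S = {s. \<not> (\<forall>i<n. i \<in> informed s)}" by auto
  also have "measure_pmf.prob (WU n p t) \<dots> \<le> (1 - p + p / c) ^ t * weight c (n - 1) / c"
    using assms by (intro prob_not_all_informed) auto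
  also have "\<dots> \<le> (1 - p + p / c) ^ t * (real n * c ^ K)"
    using mult_left_mono[OF wt zero_le_power[OF q0, of t]] by simp
  also have "\<dots> = real n * ((1 - p + p / c) ^ t * c ^ K)" by simp
  also have "\<dots> \<le> real n * exp (- ((c - 1)\<^sup>2 / (2 * c)) * (real K - 1))"
    using tail_bound[OF assms(1-3) t] by (intro mult_left_mono) auto
  finally show ?thesis unfolding K t_def by linarith
qed

end
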